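(* Let $R$ be a Noetherian commutative ring with identity that is not an integral domain. Then the nil-graph of ideals $\mathbb{AG}_N(R)$ is a complete graph if and only if either $R$ is an Artinian local ring or $R\cong F_1\times F_2$, where $F_1$ and $F_2$ are fields.
   Context: All rings are commutative with identity $1\neq 0$. ${\rm Nil}(R)$ is the nilradical (the set of nilpotent elements) of $R$. An ideal is non-trivial if it is nonzero and proper. The nil-graph of ideals $\mathbb{AG}_N(R)$ is the simple graph whose vertices are the nonzero proper ideals $I$ of $R$ for which there exists a non-trivial ideal $J$ of $R$ with $IJ\subseteq {\rm Nil}(R)$; two distinct vertices $I,J$ are adjacent if and only if $IJ\subseteq {\rm Nil}(R)$. A graph is complete if any two distinct vertices are adjacent. *)

theory Defs
  imports "HOL-Algebra.Algebra" "Graph_Theory.Pair_Digraph"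
begin

section \<open>Rings and ideals\<close>

text \<open>Descending chain condition on ideals; only used for commutative rings.\<close>

locale artinian_ring = ring +
  assumes descending_chain_stabilizes:
    "\<lbrakk> \<And>n::nat. ideal (I n) R; \<And>n. I (Suc n) \<subseteq> I n \<rbrakk> \<Longrightarrow> \<exists>N. \<forall>n\<ge>N. I n = I N"

locale local_ring = cring +
  assumes unique_maximalideal: "\<exists>!M. maximalideal M R"

definition nilradical :: "('a, 'b) ring_scheme \<Rightarrow> 'a set"
  where "nilradical R = {x \<in> carrier R. \<exists>n::nat. x [^]\<^bsub>R\<^esub> n = \<zero>\<^bsub>R\<^esub>}"

definition nontrivial_ideal :: "'a set \<Rightarrow> ('a, 'b) ring_scheme \<Rightarrow> bool"
  where "nontrivial_ideal I R \<longleftrightarrow> ideal I R \<and> I \<noteq> {\<zero>\<^bsub>R\<^esub>} \<and> I \<noteq> carrier R"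

section \<open>The nil-graph of ideals\<close>

text \<open>
  A simple graph, with possibly infinitely many vertices, is represented by a symmetric
  loop-free set of arcs, see the lemma \<open>nil_graph_simple\<close> below. The witness \<open>J\<close> in the
  vertex condition is allowed to be equal to \<open>I\<close>.
\<close>

definition nil_graph :: "('a, 'b) ring_scheme \<Rightarrow> 'a set pair_pre_digraph"
  where "nil_graph R =
    (let V = {I. nontrivial_ideal I R \<and> (\<exists>J. nontrivial_ideal J R \<and> I \<cdot>\<^bsub>R\<^esub> J \<subseteq> nilradical R)}
     in \<lparr> pverts = V,
          parcs = {(I, J). I \<in> V \<and> J \<in> V \<and> I \<noteq> J \<and> I \<cdot>\<^bsub>R\<^esub> J \<subseteq> nilradical R} \<rparr>)"

definition complete_graph :: "'v pair_pre_digraph \<Rightarrow> bool"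
  where "complete_graph G \<longleftrightarrow> (\<forall>u \<in> pverts G. \<forall>v \<in> pverts G. u \<noteq> v \<longrightarrow> (u, v) \<in> parcs G)"

lemma nil_graph_simple:
  assumes "cring R"
  shows "pair_bidirected_digraph (nil_graph R)"
proof -
  interpret cring R by fact
  show ?thesis
  proof
    show "symmetric (with_proj (nil_graph R))"
      unfolding symmetric_def with_proj_simps nil_graph_def Let_def
      by (rule symI) (auto simp: nontrivial_ideal_def ideal_prod_commute)
  qed (auto simp: nil_graph_def Let_def)
qed

section \<open>Products of two fields\<close>

text \<open>
  Existential quantification over two fields whose carriers live in the type of the elements
  of \<open>R\<close> loses no generality: the factors of \<open>R\<close> can be copied into that type.
\<close>

lemma fields_product_same_type:
  fixes R :: "('a, 'r) ring_scheme" and F\<^sub>1 :: "('b, 'm) ring_scheme" and F\<^sub>2 :: "('c, 'n) ring_scheme"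
  assumes "ring R" "field F\<^sub>1" "field F\<^sub>2" and iso: "R \<simeq> RDirProd F\<^sub>1 F\<^sub>2"
  shows "\<exists>(K\<^sub>1 :: 'a ring) (K\<^sub>2 :: 'a ring). field K\<^sub>1 \<and> field K\<^sub>2 \<and> R \<simeq> RDirProd K\<^sub>1 K\<^sub>2"
proof -
  interpret F1: field F\<^sub>1 by fact
  interpret F2: field F\<^sub>2 by fact
  obtain h where h: "h \<in> ring_iso R (RDirProd F\<^sub>1 F\<^sub>2)"
    using iso unfolding is_ring_iso_def by blast
  define g where "g = inv_into (carrier R) h"
  have "bij_betw h (carrier R) (carrier F\<^sub>1 \<times> carrier F\<^sub>2)"
    using h by (simp add: ring_iso_def RDirProd_carrier)
  then have g: "inj_on g (carrier F\<^sub>1 \<times> carrier F\<^sub>2)"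
    unfolding g_def by (metis bij_betw_imp_inj_on bij_betw_inv_into)
  define f1 where "f1 = (\<lambda>x. g (x, \<zero>\<^bsub>F\<^sub>2\<^esub>))"
  define f2 where "f2 = (\<lambda>y. g (\<zero>\<^bsub>F\<^sub>1\<^esub>, y))"
  have f1: "inj_on f1 (carrier F\<^sub>1)" and f2: "inj_on f2 (carrier F\<^sub>2)"
    unfolding f1_def f2_def by (auto intro!: inj_onI dest!: inj_onD[OF g])
  let ?K1 = "image_ring f1 F\<^sub>1" and ?K2 = "image_ring f2 F\<^sub>2"
  have "field ?K1" "field ?K2"
    using F1.inj_imp_image_ring_is_field[OF f1] F2.inj_imp_image_ring_is_field[OF f2] by auto
  moreover have "R \<simeq> RDirProd ?K1 ?K2"
    using ring_iso_set_trans[OF ring_iso_set_trans[OF h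
        RDirProd_iso4[OF inj_imp_image_ring_iso[OF f1]]]
        RDirProd_iso5[OF inj_imp_image_ring_iso[OF f2]]]
    unfolding is_ring_iso_def by blast
  ultimately show ?thesis by blast
qed

end

theory Submission
  imports Defs
begin

text \<open>
  A proper nonzero ideal is a vertex of the nil-graph as soon as some nonzero nonunit \<open>z\<close>
  multiplies it into the nilradical. Completeness is exploited by exhibiting two vertices
  \<open>I\<close>, \<open>J\<close> with elements whose product is not nilpotent: they have to be equal.

  Assume that the graph is complete, and let \<open>x\<close> be a nonunit that is not nilpotent although
  \<open>xz\<close> is nilpotent for some nonzero nonunit \<open>z\<close>. Then \<open>(x)\<close> and \<open>(x\<^sup>2)\<close> are vertices and \<open>x\<^sup>3\<close>
  is not nilpotent, so \<open>(x) = (x\<^sup>2)\<close>. Writing \<open>x = r x\<^sup>2\<close> yields the nontrivial idempotent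
  \<open>rx\<close> (lemma \<open>complete_nil_graph_idempotent\<close>). This leaves two cases.

  If there is a nontrivial idempotent \<open>e\<close>, then \<open>(e)\<close> and \<open>(1 - e)\<close> are both maximal
  (lemma \<open>complete_nil_graph_idempotent_maximalideal\<close>). They are comaximal and meet in zero, so
  the Chinese remainder map is an isomorphism of \<open>R\<close> with a product of two fields.

  If there is none, a zero divisor \<open>a\<close>, say \<open>ab = 0\<close>, must be nilpotent, and then \<open>a\<close> itself can
  serve as \<open>z\<close> for every nonunit: all nonunits are nilpotent. Hence the nilradical is the only
  maximal ideal. The descending chain condition follows by Noetherian induction, because over
  every proper ideal \<open>A\<close> there is an ideal \<open>A + (x)\<close> such that \<open>(A + (x))/A\<close> is simple
  (lemmas \<open>exists_socle_element\<close> and \<open>artinian_of_nilpotent_nonunits\<close>).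

  Conversely, all nonunits of an Artinian local ring are nilpotent, so any two proper ideals have
  their product in the nilradical. In a product of two fields, the only nonzero proper ideals are
  the two factors, and their product is zero.
\<close>

section \<open>Nilpotent elements and products of ideals\<close>

context cring
begin

lemma nilpotent_sum:
  assumes x: "x \<in> carrier R" and y: "y \<in> carrier R"
    and xm: "x [^] (m::nat) = \<zero>" and yn: "y [^] (n::nat) = \<zero>"
  shows "(x \<oplus> y) [^] (m + n) = \<zero>"
proof -
  have zero_beyond: "z [^] i = \<zero>" if "z \<in> carrier R" "z [^] k = \<zero>" "k \<le> i" for z and i k :: nat
  proof -
    have "z [^] i = z [^] k \<otimes> z [^] (i - k)"
      using nat_pow_mult[OF that(1), of k "i - k"] that(3) by simp
    then show ?thesis using that(1,2) by simp
  qed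
  (* Splitting one factor x + y off raises the exponent of x or of y, so i + j + k is preserved;
     when k = 0, one of the two exponents is large enough. This replaces the binomial expansion. *)
  have "\<forall>i j. m + n \<le> i + j + k \<longrightarrow> x [^] i \<otimes> y [^] j \<otimes> (x \<oplus> y) [^] k = \<zero>" for k :: nat
  proof (induction k)
    case 0
    show ?case
    proof (intro allI impI)
      fix i j :: nat assume "m + n \<le> i + j + 0"
      then have "m \<le> i \<or> n \<le> j" by linarith
      then show "x [^] i \<otimes> y [^] j \<otimes> (x \<oplus> y) [^] (0::nat) = \<zero>"
        using zero_beyond[OF x xm] zero_beyond[OF y yn] x y by auto
    qed
  next
    case (Suc k)
    show ?case
    proof (intro allI impI)
      fix i j :: nat assume le: "m + n \<le> i + j + Suc k"
      let ?s = "(x \<oplus> y) [^] k"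
      have "x [^] i \<otimes> y [^] j \<otimes> (x \<oplus> y) [^] Suc k
          = x [^] Suc i \<otimes> y [^] j \<otimes> ?s \<oplus> x [^] i \<otimes> y [^] Suc j \<otimes> ?s"
        using x y by (simp add: l_distr r_distr m_ac)
      also have "\<dots> = \<zero>"
        using Suc.IH[rule_format, of "Suc i" j] Suc.IH[rule_format, of i "Suc j"] le by simp
      finally show "x [^] i \<otimes> y [^] j \<otimes> (x \<oplus> y) [^] Suc k = \<zero>" .
    qed
  qed
  from this[of "m + n", rule_format, of 0 0] show ?thesis using x y by simp
qed

lemma nilradical_ideal: "ideal (nilradical R) R"
proof (rule idealI)
  have scale: "a \<otimes> x \<in> nilradical R" if nil: "x \<in> nilradical R" and a: "a \<in> carrier R" for a x
  proof -
    obtain n :: nat where n: "x [^] n = \<zero>" and x: "x \<in> carrier R"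
      using nil by (auto simp: nilradical_def)
    have "(a \<otimes> x) [^] n = \<zero>" using n x a by (simp add: nat_pow_distrib)
    then show ?thesis using x a by (auto simp: nilradical_def)
  qed
  show "subgroup (nilradical R) (add_monoid R)"
  proof (rule add.subgroupI)
    have "\<zero> [^] (1::nat) = \<zero>" by simp
    then show "nilradical R \<noteq> {}" unfolding nilradical_def by blast
    show "\<ominus> x \<in> nilradical R" if "x \<in> nilradical R" for x
    proof -
      have "\<ominus> \<one> \<otimes> x = \<ominus> x" using that by (simp add: nilradical_def l_minus)
      then show ?thesis using scale[OF that, of "\<ominus> \<one>"] by simp
    qed
    show "x \<oplus> y \<in> nilradical R" if "x \<in> nilradical R" "y \<in> nilradical R" for x y
      using that nilpotent_sum by (fastforce simp: nilradical_def)
  qed (auto simp: nilradical_def)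
  show "a \<otimes> x \<in> nilradical R" if "x \<in> nilradical R" "a \<in> carrier R" for a x
    using scale that .
  then show "x \<otimes> a \<in> nilradical R" if "x \<in> nilradical R" "a \<in> carrier R" for a x
    using that by (metis (no_types, lifting) m_comm mem_Collect_eq nilradical_def)
qed (rule ring_axioms)

text \<open>
  Because the nilradical is closed under addition, adjacency in the nil-graph can be tested on
  products of single elements.
\<close>

lemma ideal_prod_subset_nilradical_iff:
  "I \<cdot> J \<subseteq> nilradical R \<longleftrightarrow> (\<forall>x\<in>I. \<forall>y\<in>J. x \<otimes> y \<in> nilradical R)"
proof
  assume products: "\<forall>x\<in>I. \<forall>y\<in>J. x \<otimes> y \<in> nilradical R"
  show "I \<cdot> J \<subseteq> nilradical R"
  proof
    fix s assume "s \<in> I \<cdot> J"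
    then show "s \<in> nilradical R"
      by induction
        (auto simp: products additive_subgroup.a_closed[OF ideal.axioms(1)[OF nilradical_ideal]])
  qed
qed (auto intro: ideal_prod.prod)

lemma nilradical_of_pow:
  assumes "x \<in> carrier R" and "x [^] (k::nat) \<in> nilradical R"
  shows "x \<in> nilradical R"
  using assms by (auto simp: nilradical_def nat_pow_pow)

text \<open>
  All positive powers of an idempotent are equal to it.
\<close>

lemma nilpotent_idempotent_eq_zero:
  assumes e: "e \<otimes> e = e" and nil: "e \<in> nilradical R"
  shows "e = \<zero>"
proof -
  obtain n :: nat where n: "e [^] n = \<zero>" and ec: "e \<in> carrier R"
    using nil by (auto simp: nilradical_def)
  have "e [^] Suc k = e" for k :: nat
    by (induction k) (use e ec in auto)
  from this[of n] show ?thesis using n ec by simp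
qed

lemma cgenideal_eq_carrier_iff:
  assumes "x \<in> carrier R"
  shows "PIdl x = carrier R \<longleftrightarrow> x \<in> Units R"
proof
  assume "PIdl x = carrier R"
  then have "\<one> \<in> PIdl x" by simp
  then obtain r where r: "r \<in> carrier R" "\<one> = r \<otimes> x" unfolding cgenideal_def by blast
  then have "x \<otimes> r \<in> Units R" using m_comm[OF assms r(1)] Units_one_closed by simp
  then show "x \<in> Units R" by (rule unit_factor[OF _ assms r(1)])
next
  assume x: "x \<in> Units R"
  have "PIdl x \<subseteq> carrier R" using assms by (auto simp: cgenideal_def)
  moreover have "\<one> \<in> PIdl x"
    using x unfolding Units_def cgenideal_def by force
  ultimately show "PIdl x = carrier R"
    using ideal.one_imp_carrier[OF cgenideal_ideal[OF assms]] by blast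
qed

lemma nontrivial_ideal_cgenideal:
  assumes "x \<in> carrier R" "x \<noteq> \<zero>" "x \<notin> Units R"
  shows "nontrivial_ideal (PIdl x) R"
  using assms cgenideal_ideal cgenideal_self[of x] cgenideal_eq_carrier_iff
  unfolding nontrivial_ideal_def by auto

lemma proper_ideal_nonunit:
  assumes "ideal I R" "I \<noteq> carrier R" "x \<in> I"
  shows "x \<notin> Units R"
proof
  assume x: "x \<in> Units R"
  have "PIdl x \<subseteq> I" by (rule cgenideal_minimal[OF assms(1,3)])
  then show False
    using assms x cgenideal_eq_carrier_iff ideal.Icarr[OF assms(1)] by blast
qed

section \<open>Complete nil-graphs and idempotents\<close>

text \<open>
  The principal ideal \<open>(z)\<close> is the second ideal required by the definition of a vertex.
\<close>

lemma nil_graph_vertexI: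
  assumes I: "nontrivial_ideal I R" and z: "z \<in> carrier R" "z \<noteq> \<zero>" "z \<notin> Units R"
    and nil: "\<And>x. x \<in> I \<Longrightarrow> x \<otimes> z \<in> nilradical R"
  shows "I \<in> pverts (nil_graph R)"
proof -
  have "x \<otimes> y \<in> nilradical R" if "x \<in> I" "y \<in> PIdl z" for x y
  proof -
    obtain r where r: "r \<in> carrier R" "y = r \<otimes> z" using \<open>y \<in> PIdl z\<close> by (auto simp: cgenideal_def)
    have "x \<in> carrier R" using I that(1) ideal.Icarr unfolding nontrivial_ideal_def by metis
    then have "x \<otimes> y = r \<otimes> (x \<otimes> z)" using r z by (simp add: m_lcomm)
    then show ?thesis using ideal.I_l_closed[OF nilradical_ideal nil[OF that(1)] r(1)] by simp
  qed
  then have "I \<cdot> (PIdl z) \<subseteq> nilradical R" by (simp add: ideal_prod_subset_nilradical_iff)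
  then show ?thesis
    using I nontrivial_ideal_cgenideal[OF z] unfolding nil_graph_def Let_def by auto
qed

lemma nil_graph_vertex_cgenidealI:
  assumes x: "x \<in> carrier R" "x \<noteq> \<zero>" "x \<notin> Units R"
    and z: "z \<in> carrier R" "z \<noteq> \<zero>" "z \<notin> Units R"
    and nil: "x \<otimes> z \<in> nilradical R"
  shows "PIdl x \<in> pverts (nil_graph R)"
proof (rule nil_graph_vertexI[OF nontrivial_ideal_cgenideal[OF x] z])
  fix u assume "u \<in> PIdl x"
  then obtain r where "r \<in> carrier R" "u = r \<otimes> x" by (auto simp: cgenideal_def)
  then show "u \<otimes> z \<in> nilradical R"
    using x z ideal.I_l_closed[OF nilradical_ideal nil] by (simp add: m_assoc)
qed

text \<open>
  The form in which completeness is used: vertices that are not adjacent must coincide.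
\<close>

lemma complete_nil_graphD:
  assumes "complete_graph (nil_graph R)" "I \<in> pverts (nil_graph R)" "J \<in> pverts (nil_graph R)"
    and "x \<in> I" "y \<in> J" "x \<otimes> y \<notin> nilradical R"
  shows "I = J"
proof (rule ccontr)
  assume "I \<noteq> J"
  then have "(I, J) \<in> parcs (nil_graph R)" using assms unfolding complete_graph_def by blast
  then have "I \<cdot> J \<subseteq> nilradical R" unfolding nil_graph_def Let_def by auto
  then show False using assms by (auto simp: ideal_prod_subset_nilradical_iff)
qed

lemma nontrivial_idempotent_compl:
  assumes e: "e \<in> carrier R" "e \<otimes> e = e" "e \<noteq> \<zero>" "e \<noteq> \<one>"
  shows "\<one> \<ominus> e \<in> carrier R" "(\<one> \<ominus> e) \<otimes> (\<one> \<ominus> e) = \<one> \<ominus> e" "\<one> \<ominus> e \<noteq> \<zero>" "\<one> \<ominus> e \<noteq> \<one>"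
    "e \<otimes> (\<one> \<ominus> e) = \<zero>" "e \<oplus> (\<one> \<ominus> e) = \<one>"
proof -
  show "e \<oplus> (\<one> \<ominus> e) = \<one>" using e by (simp add: minus_eq a_lcomm[of e \<one>] r_neg)
  show c: "\<one> \<ominus> e \<in> carrier R" using e by simp
  show z: "e \<otimes> (\<one> \<ominus> e) = \<zero>"
    using e by (simp add: minus_eq r_distr r_minus r_neg)
  have "(\<one> \<ominus> e) \<otimes> (\<one> \<ominus> e) = (\<one> \<ominus> e) \<ominus> e \<otimes> (\<one> \<ominus> e)"
    using e c by (simp add: minus_eq l_distr l_minus)
  then show "(\<one> \<ominus> e) \<otimes> (\<one> \<ominus> e) = \<one> \<ominus> e" using z c by (simp add: minus_eq)
  show "\<one> \<ominus> e \<noteq> \<zero>" using e by simp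
  show "\<one> \<ominus> e \<noteq> \<one>"
  proof
    assume "\<one> \<ominus> e = \<one>"
    then show False using z e by simp
  qed
qed

lemma nontrivial_idempotent_nonunit:
  assumes e: "e \<in> carrier R" "e \<otimes> e = e" "e \<noteq> \<one>"
  shows "e \<notin> Units R"
  using e by (metis Units_l_cancel one_closed r_one)

text \<open>
  The vertices \<open>(x)\<close> and \<open>(x\<^sup>2)\<close> cannot be adjacent, as \<open>x\<^sup>3\<close> is not nilpotent, so they are
  equal; from \<open>x = r x\<^sup>2\<close> the element \<open>rx\<close> is idempotent. It is nonzero because \<open>rx\<close> fixes \<open>x\<close>,
  and it is not one because \<open>x\<close> is a nonunit.
\<close>

lemma complete_nil_graph_idempotent:
  assumes complete: "complete_graph (nil_graph R)"
    and x: "x \<in> carrier R" "x \<notin> Units R" "x \<notin> nilradical R"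
    and z: "z \<in> carrier R" "z \<noteq> \<zero>" "z \<notin> Units R" and nil: "x \<otimes> z \<in> nilradical R"
  shows "\<exists>e\<in>carrier R. e \<otimes> e = e \<and> e \<noteq> \<zero> \<and> e \<noteq> \<one>"
proof -
  have zero_nil: "\<zero> \<in> nilradical R"
    by (rule additive_subgroup.zero_closed[OF ideal.axioms(1)[OF nilradical_ideal]])
  have square: "x \<otimes> x = x [^] (2::nat)" and cube: "x \<otimes> (x \<otimes> x) = x [^] (3::nat)"
    using x by (simp_all add: numeral_eq_Suc m_assoc)
  have nz: "x \<noteq> \<zero>" "x \<otimes> x \<noteq> \<zero>"
    using x zero_nil nilradical_of_pow[OF x(1), of 2] square by auto
  have "x \<otimes> x \<notin> Units R" using x by (metis unit_factor)
  moreover have "(x \<otimes> x) \<otimes> z \<in> nilradical R"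
    using ideal.I_l_closed[OF nilradical_ideal nil x(1)] x z by (simp add: m_assoc)
  ultimately have "PIdl (x \<otimes> x) \<in> pverts (nil_graph R)"
    using nil_graph_vertex_cgenidealI[of "x \<otimes> x" z] x z nz by simp
  moreover have "PIdl x \<in> pverts (nil_graph R)"
    using nil_graph_vertex_cgenidealI[of x z] x z nz nil by simp
  moreover have "x \<otimes> (x \<otimes> x) \<notin> nilradical R"
    using nilradical_of_pow[OF x(1), of 3] x cube by auto
  ultimately have "PIdl x = PIdl (x \<otimes> x)"
    using complete_nil_graphD[OF complete, of "PIdl x" "PIdl (x \<otimes> x)" x "x \<otimes> x"]
      cgenideal_self x by simp
  then have "x \<in> PIdl (x \<otimes> x)" using cgenideal_self[OF x(1)] by simp
  then obtain r where r: "r \<in> carrier R" "x = r \<otimes> (x \<otimes> x)" by (auto simp: cgenideal_def)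
  let ?e = "r \<otimes> x"
  have absorb: "?e \<otimes> x = x" using r(2) m_assoc[OF r(1) x(1) x(1)] by simp
  have "?e \<otimes> ?e = r \<otimes> (?e \<otimes> x)" using r(1) x(1) by (simp add: m_ac)
  then have "?e \<otimes> ?e = ?e" using absorb by simp
  moreover have "?e \<noteq> \<zero>" using absorb nz x by force
  moreover have "?e \<noteq> \<one>"
    using x r(1) m_comm[OF r(1) x(1)] unit_factor[of x r] by auto
  ultimately show ?thesis using r(1) x(1) by blast
qed

text \<open>
  A proper ideal \<open>J\<close> strictly above \<open>(e)\<close> contains a nonzero element \<open>y\<close> of \<open>(1 - e)\<close>. If \<open>y\<close> is
  nilpotent, it makes \<open>J\<close> a vertex; then \<open>J\<close> and \<open>(e)\<close> would be adjacent although they share the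
  element \<open>e\<close>, which is not nilpotent. If \<open>y\<close> is not nilpotent, then \<open>(y)\<close> and \<open>(1 - e)\<close> are vertices
  whose product contains \<open>y\<close>, so they are equal and \<open>J\<close> contains \<open>e + (1 - e) = 1\<close>.
\<close>

lemma complete_nil_graph_idempotent_maximalideal:
  assumes complete: "complete_graph (nil_graph R)"
    and e: "e \<in> carrier R" "e \<otimes> e = e" "e \<noteq> \<zero>" "e \<noteq> \<one>"
  shows "maximalideal (PIdl e) R"
proof (rule maximalidealI)
  let ?f = "\<one> \<ominus> e"
  note f = nontrivial_idempotent_compl[OF e]
  have eu: "e \<notin> Units R" and fu: "?f \<notin> Units R"
    using nontrivial_idempotent_nonunit e f by auto
  have zero_nil: "\<zero> \<in> nilradical R"
    by (rule additive_subgroup.zero_closed[OF ideal.axioms(1)[OF nilradical_ideal]])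
  have e_vertex: "PIdl e \<in> pverts (nil_graph R)" and f_vertex: "PIdl ?f \<in> pverts (nil_graph R)"
    using nil_graph_vertex_cgenidealI[of e ?f] nil_graph_vertex_cgenidealI[of ?f e]
      e f eu fu zero_nil by (simp_all add: m_comm)
  show "ideal (PIdl e) R" using cgenideal_ideal e by simp
  show "carrier R \<noteq> PIdl e" using cgenideal_eq_carrier_iff e eu by blast
  fix J assume J: "ideal J R" "PIdl e \<subseteq> J" "J \<subseteq> carrier R"
  show "J = PIdl e \<or> J = carrier R"
  proof (rule ccontr)
    assume "\<not> (J = PIdl e \<or> J = carrier R)"
    then have ne: "J \<noteq> PIdl e" and proper: "J \<noteq> carrier R" by auto
    have eJ: "e \<in> J" using J(2) cgenideal_self e by blast
    obtain x where x: "x \<in> J" "x \<notin> PIdl e" using ne J(2) by blast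
    have xc: "x \<in> carrier R" using x J by blast
    (* The component of x in the complementary factor (1 - e). *)
    define y where "y = x \<otimes> ?f"
    have yc: "y \<in> carrier R" and yJ: "y \<in> J"
      using xc f(1) x ideal.I_r_closed[OF J(1)] by (auto simp: y_def)
    have split: "x = x \<otimes> e \<oplus> y"
    proof -
      have "x \<otimes> e \<oplus> y = x \<otimes> (e \<oplus> ?f)" using xc e(1) f(1) by (simp add: y_def r_distr)
      then show ?thesis using xc f(6) by simp
    qed
    have y0: "y \<noteq> \<zero>" 
    proof
      assume "y = \<zero>"
      then have "x = x \<otimes> e" using split xc e by (metis m_closed r_zero)
      then show False using x(2) xc unfolding cgenideal_def by blast
    qed
    have yu: "y \<notin> Units R" using proper_ideal_nonunit J proper yJ by blast
    have yf: "y \<otimes> ?f = y" using xc f by (simp add: y_def m_assoc)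
    have ye: "y \<otimes> e = \<zero>" using xc f e by (simp add: y_def m_assoc m_comm[of ?f e])
    show False
    proof (cases "y \<in> nilradical R")
      case True
      have "nontrivial_ideal J R"
        using J proper eJ e unfolding nontrivial_ideal_def by auto
      moreover have "u \<otimes> y \<in> nilradical R" if "u \<in> J" for u
        using ideal.I_l_closed[OF nilradical_ideal True] that J by blast
      ultimately have "J \<in> pverts (nil_graph R)"
        using nil_graph_vertexI yc y0 yu by blast
      then have "J = PIdl e"
        using complete_nil_graphD[OF complete _ e_vertex eJ cgenideal_self[OF e(1)]]
          nilpotent_idempotent_eq_zero[OF e(2)] e by auto
      then show False using ne by simp
    next
      case False
      have "PIdl y \<in> pverts (nil_graph R)"
        using nil_graph_vertex_cgenidealI[of y e] yc y0 yu e eu ye zero_nil by simp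
      then have "PIdl y = PIdl ?f"
        using complete_nil_graphD[OF complete _ f_vertex cgenideal_self[OF yc] cgenideal_self[OF f(1)]]
          yf False by simp
      then have "?f \<in> PIdl y" using cgenideal_self[OF f(1)] by simp
      then have "?f \<in> J" using cgenideal_minimal[OF J(1) yJ] by blast
      then have "e \<oplus> ?f \<in> J"
        using eJ additive_subgroup.a_closed[OF ideal.axioms(1)[OF J(1)]] by blast
      then show False using f(6) ideal.one_imp_carrier[OF J(1)] proper by simp
    qed
  qed
qed

text \<open>
  Both factors are quotients by maximal ideals. The Chinese remainder map is surjective because
  \<open>e + (1 - e) = 1\<close>, and injective because \<open>e (1 - e) = 0\<close> makes the two ideals meet in zero. The
  quotients have sets as elements; copies of them with elements in the type of \<open>R\<close> are taken at
  the end.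
\<close>

lemma idempotent_product_of_fields:
  assumes e: "e \<in> carrier R" "e \<otimes> e = e" "e \<noteq> \<zero>" "e \<noteq> \<one>"
    and max: "maximalideal (PIdl e) R" "maximalideal (PIdl (\<one> \<ominus> e)) R"
  shows "\<exists>(F\<^sub>1 :: 'a ring) (F\<^sub>2 :: 'a ring). field F\<^sub>1 \<and> field F\<^sub>2 \<and> R \<simeq> RDirProd F\<^sub>1 F\<^sub>2"
proof -
  let ?f = "\<one> \<ominus> e"
  let ?I = "PIdl e" and ?J = "PIdl ?f"
  note f = nontrivial_idempotent_compl[OF e]
  have I: "ideal ?I R" and J: "ideal ?J R" using cgenideal_ideal e f by auto
  have inter: "?I \<inter> ?J = {\<zero>}"
  proof
    show "?I \<inter> ?J \<subseteq> {\<zero>}"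
    proof
      fix u assume "u \<in> ?I \<inter> ?J"
      then obtain r s where r: "r \<in> carrier R" "u = r \<otimes> e" and s: "s \<in> carrier R" "u = s \<otimes> ?f"
        by (auto simp: cgenideal_def)
      have "u = u \<otimes> e" using r e by (simp add: m_assoc)
      also have "\<dots> = \<zero>" using s e f by (simp add: m_assoc m_comm[of ?f e])
      finally show "u \<in> {\<zero>}" by simp
    qed
    show "{\<zero>} \<subseteq> ?I \<inter> ?J"
      using additive_subgroup.zero_closed[OF ideal.axioms(1)] I J by auto
  qed
  have "\<one> \<in> ?I <+> ?J"
    using f(6) cgenideal_self[OF e(1)] cgenideal_self[OF f(1)] unfolding set_add_def' by force
  then have "?I <+> ?J = carrier R"
    using ideal.one_imp_carrier[OF add_ideals[OF I J]] by blast
  then have "canonical_proj ?I ?J ` carrier R = carrier (RDirProd (R Quot ?I) (R Quot ?J))"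
    by (rule canonical_proj_is_surj[OF I J])
  moreover have hom: "ring_hom_ring R (RDirProd (R Quot ?I) (R Quot ?J)) (canonical_proj ?I ?J)"
    by (rule canonical_proj_ring_hom[OF I J])
  moreover have "inj_on (canonical_proj ?I ?J) (carrier R)"
    using ring_hom_ring.trivial_ker_imp_inj[OF hom] canonical_proj_ker[OF I J] inter by simp
  ultimately have "canonical_proj ?I ?J \<in> ring_iso R (RDirProd (R Quot ?I) (R Quot ?J))"
    unfolding ring_iso_def bij_betw_def using canonical_proj_is_hom[OF I J] by simp
  then have "R \<simeq> RDirProd (R Quot ?I) (R Quot ?J)" unfolding is_ring_iso_def by blast
  moreover have "field (R Quot ?I)" "field (R Quot ?J)"
    using maximalideal.quotient_is_field max is_cring by auto
  ultimately show ?thesis using fields_product_same_type[OF ring_axioms] by blast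
qed

end

section \<open>Noetherian rings whose nonunits are nilpotent\<close>

text \<open>
  Zorn's lemma applies because the union of a chain of ideals belongs to the chain.
\<close>

lemma (in noetherian_ring) ideal_family_has_maximal:
  assumes "I \<in> \<F>" and "\<And>I. I \<in> \<F> \<Longrightarrow> ideal I R"
  obtains M where "M \<in> \<F>" and "\<And>K. K \<in> \<F> \<Longrightarrow> M \<subseteq> K \<Longrightarrow> K = M"
proof -
  have "\<Union>C \<in> \<F>" if C: "C \<noteq> {}" "subset.chain \<F> C" for C
  proof -
    have "subset.chain {I. ideal I R} C"
      using C(2) assms(2) unfolding pred_on.chain_def by auto
    then have "\<Union>C \<in> C" by (rule ideal_chain_is_trivial[OF C(1)])
    then show ?thesis using C(2) unfolding pred_on.chain_def by auto
  qed
  then have "\<exists>M\<in>\<F>. \<forall>K\<in>\<F>. M \<subseteq> K \<longrightarrow> K = M"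
    using subset_Zorn_nonempty[of \<F>] assms(1) by blast
  then show thesis using that by blast
qed

context cring
begin

lemma colon_ideal:
  assumes A: "ideal A R" and x: "x \<in> carrier R"
  shows "ideal {r \<in> carrier R. r \<otimes> x \<in> A} R"
proof (rule idealI)
  note A_add = ideal.axioms(1)[OF A]
  show "subgroup {r \<in> carrier R. r \<otimes> x \<in> A} (add_monoid R)"
  proof (rule add.subgroupI)
    have "\<zero> \<in> {r \<in> carrier R. r \<otimes> x \<in> A}"
      using x additive_subgroup.zero_closed[OF A_add] by simp
    then show "{r \<in> carrier R. r \<otimes> x \<in> A} \<noteq> {}" by blast
  next
    fix r assume r: "r \<in> {r \<in> carrier R. r \<otimes> x \<in> A}"
    then have "\<ominus> (r \<otimes> x) \<in> A" by (simp add: additive_subgroup.a_inv_closed[OF A_add])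
    then show "\<ominus> r \<in> {r \<in> carrier R. r \<otimes> x \<in> A}" using r x by (simp add: l_minus)
  next
    fix r s assume "r \<in> {r \<in> carrier R. r \<otimes> x \<in> A}" "s \<in> {r \<in> carrier R. r \<otimes> x \<in> A}"
    then show "r \<oplus> s \<in> {r \<in> carrier R. r \<otimes> x \<in> A}"
      using x by (simp add: l_distr additive_subgroup.a_closed[OF A_add])
  qed auto
next
  fix r s assume rs: "r \<in> {r \<in> carrier R. r \<otimes> x \<in> A}" "s \<in> carrier R"
  then have "s \<otimes> (r \<otimes> x) \<in> A" by (simp add: ideal.I_l_closed[OF A])
  then show "s \<otimes> r \<in> {r \<in> carrier R. r \<otimes> x \<in> A}" using rs x by (simp add: m_assoc)
  then show "r \<otimes> s \<in> {r \<in> carrier R. r \<otimes> x \<in> A}" using rs by (simp add: m_comm)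
qed (rule ring_axioms)

text \<open>
  Such an element spans a simple submodule of \<open>R/A\<close>. It is found by choosing \<open>x\<close> outside \<open>A\<close> with a
  maximal colon ideal \<open>(A : x)\<close>. If a nonunit \<open>y\<close> had \<open>yx\<close> outside \<open>A\<close>, then \<open>(A : yx) = (A : x)\<close> by
  maximality, so multiplying repeatedly by \<open>y\<close> would never lead into \<open>A\<close>, contradicting that \<open>y\<close>
  is nilpotent.
\<close>

lemma exists_socle_element:
  assumes noetherian: "noetherian_ring R"
    and nonunits: "\<And>y. y \<in> carrier R \<Longrightarrow> y \<notin> Units R \<Longrightarrow> y \<in> nilradical R"
    and A: "ideal A R" "A \<noteq> carrier R"
  obtains x where "x \<in> carrier R" "x \<notin> A"
    and "\<And>y. y \<in> carrier R \<Longrightarrow> y \<notin> Units R \<Longrightarrow> y \<otimes> x \<in> A"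
proof -
  define colon where "colon x = {r \<in> carrier R. r \<otimes> x \<in> A}" for x
  define \<F> where "\<F> = colon ` (carrier R - A)"
  obtain x0 where "x0 \<in> carrier R" "x0 \<notin> A"
    using A ideal.Icarr[OF A(1)] by blast
  then have "colon x0 \<in> \<F>" by (auto simp: \<F>_def)
  moreover have "ideal I R" if "I \<in> \<F>" for I
    using that colon_ideal[OF A(1)] by (auto simp: \<F>_def colon_def)
  ultimately obtain M where "M \<in> \<F>" and M_max: "\<And>K. K \<in> \<F> \<Longrightarrow> M \<subseteq> K \<Longrightarrow> K = M"
    using noetherian_ring.ideal_family_has_maximal[OF noetherian, of "colon x0" \<F>] by blast
  then obtain x where x: "x \<in> carrier R" "x \<notin> A" and M: "M = colon x"
    by (auto simp: \<F>_def)
  have "y \<otimes> x \<in> A" if y: "y \<in> carrier R" "y \<notin> Units R" for y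
  proof (rule ccontr)
    assume yx: "y \<otimes> x \<notin> A"
    have "colon x \<subseteq> colon (y \<otimes> x)"
      using x y by (auto simp: colon_def m_lcomm[of _ y x] ideal.I_l_closed[OF A(1)])
    then have same: "colon (y \<otimes> x) = colon x"
      using M_max[of "colon (y \<otimes> x)"] M x y yx by (auto simp: \<F>_def)
    have powers: "y [^] k \<notin> colon x" for k :: nat
    proof (induction k)
      case 0
      show ?case using x by (simp add: colon_def)
    next
      case (Suc k)
      then have "y [^] k \<otimes> (y \<otimes> x) \<notin> A" using same y by (auto simp: colon_def)
      then show ?case using x y by (simp add: colon_def m_assoc)
    qed
    obtain n :: nat where "y [^] n = \<zero>"
      using nonunits[OF y] by (auto simp: nilradical_def)
    then show False
      using powers[of n] x additive_subgroup.zero_closed[OF ideal.axioms(1)[OF A(1)]]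
      by (simp add: colon_def)
  qed
  then show thesis using that x by blast
qed

text \<open>
  By Noetherian induction. Let \<open>M\<close> be maximal
  among the ideals that admit a chain above them that does not stabilise, and choose \<open>B = M + (x)\<close>
  with \<open>B/M\<close> simple. For such a chain \<open>I\<^sub>n\<close>, the sums \<open>I\<^sub>n + B\<close> stabilise by maximality of \<open>M\<close>, and the
  intersections of \<open>I\<^sub>n\<close> with \<open>B\<close> stabilise because they can only be \<open>M\<close> or \<open>B\<close>. By the modular law
  the chain itself stabilises. The descending chain condition is the case of the zero ideal.
\<close>

lemma artinian_of_nilpotent_nonunits:
  assumes noetherian: "noetherian_ring R"
    and nonunits: "\<And>y. y \<in> carrier R \<Longrightarrow> y \<notin> Units R \<Longrightarrow> y \<in> nilradical R"
  shows "artinian_ring R"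
proof -
  define chain_above where "chain_above A I \<longleftrightarrow>
    (\<forall>n. ideal (I n) R \<and> A \<subseteq> I n \<and> I (Suc n) \<subseteq> I n)" for A and I :: "nat \<Rightarrow> 'a set"
  define dcc_above where "dcc_above A \<longleftrightarrow>
    (\<forall>I. chain_above A I \<longrightarrow> (\<exists>N. \<forall>n\<ge>N. I n = I N))" for A
  have "dcc_above A" if "ideal A R" for A
  proof (rule ccontr)
    assume "\<not> dcc_above A"
    then have "A \<in> {A. ideal A R \<and> \<not> dcc_above A}" using that by simp
    then obtain M where M: "ideal M R" "\<not> dcc_above M"
      and max: "\<And>K. ideal K R \<Longrightarrow> \<not> dcc_above K \<Longrightarrow> M \<subseteq> K \<Longrightarrow> K = M"
      using noetherian_ring.ideal_family_has_maximal[OF noetherian, of A "{A. ideal A R \<and> \<not> dcc_above A}"]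
      by (metis (mono_tags, lifting) mem_Collect_eq)
    obtain I where I: "chain_above M I" and unstable: "\<not> (\<exists>N. \<forall>n\<ge>N. I n = I N)"
      using M(2) by (auto simp: dcc_above_def)
    have Ii: "ideal (I n) R" and MI: "M \<subseteq> I n" and step: "I (Suc n) \<subseteq> I n" for n
      using I by (auto simp: chain_above_def)
    have anti: "I n \<subseteq> I m" if "m \<le> n" for m n
      using lift_Suc_antimono_le[of I, OF step that] .
    have "M \<noteq> carrier R"
    proof
      assume "M = carrier R"
      then have "I n = carrier R" for n using MI ideal.Icarr[OF Ii] by blast
      then show False using unstable by simp
    qed
    then obtain x where x: "x \<in> carrier R" "x \<notin> M"
      and socle: "\<And>y. y \<in> carrier R \<Longrightarrow> y \<notin> Units R \<Longrightarrow> y \<otimes> x \<in> M"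
      using exists_socle_element[OF noetherian nonunits M(1)] by blast
    define B :: "'a set" where "B = M <+> PIdl x"
    have add_iff: "u \<in> K <+> L \<longleftrightarrow> (\<exists>a\<in>K. \<exists>b\<in>L. u = a \<oplus> b)" for u K L
      by (auto simp: set_add_def')
    have zero_mem: "\<zero> \<in> K" if "ideal K R" for K
      by (rule additive_subgroup.zero_closed[OF ideal.axioms(1)[OF that]])
    have sup_left: "K \<subseteq> K <+> L" and sup_right: "L \<subseteq> K <+> L" if "ideal K R" "ideal L R" for K L
    proof -
      show "K \<subseteq> K <+> L"
      proof
        fix u assume "u \<in> K"
        then show "u \<in> K <+> L" unfolding add_iff
          using zero_mem[OF that(2)] ideal.Icarr[OF that(1)] by (intro bexI[of _ u] bexI[of _ \<zero>]) auto
      qed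
      show "L \<subseteq> K <+> L"
      proof
        fix u assume "u \<in> L"
        then show "u \<in> K <+> L" unfolding add_iff
          using zero_mem[OF that(1)] ideal.Icarr[OF that(2)] by (intro bexI[of _ u] bexI[of _ \<zero>]) auto
      qed
    qed
    have xi: "ideal (PIdl x) R" by (rule cgenideal_ideal[OF x(1)])
    have B: "ideal B R" unfolding B_def by (rule add_ideals[OF M(1) xi])
    have MB: "M \<subseteq> B" unfolding B_def by (rule sup_left[OF M(1) xi])
    have xB: "x \<in> B" unfolding B_def using sup_right[OF M(1) xi] cgenideal_self[OF x(1)] by blast
    have "dcc_above B" using max[OF B] MB xB x(2) by blast
    moreover have "chain_above B (\<lambda>n. I n <+> B)"
      unfolding chain_above_def
    proof (intro allI conjI)
      fix n
      show "ideal (I n <+> B) R" by (rule add_ideals[OF Ii B])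
      show "B \<subseteq> I n <+> B" by (rule sup_right[OF Ii B])
      show "(I (Suc n) <+> B :: 'a set) \<subseteq> I n <+> B"
        using step[of n] unfolding set_add_def' by blast
    qed
    ultimately have "\<exists>N. \<forall>n\<ge>N. (I n <+> B :: 'a set) = I N <+> B" by (auto simp: dcc_above_def)
    then obtain N1 where N1: "\<And>n. N1 \<le> n \<Longrightarrow> (I n <+> B :: 'a set) = I N1 <+> B" by blast
    (* An element a + r x of B outside M has a unit coefficient r, as nonunits send x into M. *)
    have simple: "I n \<inter> B = M \<or> B \<subseteq> I n" for n
    proof (cases "I n \<inter> B \<subseteq> M")
      case True
      then show ?thesis using MI[of n] MB by blast
    next
      case False
      then obtain k where k: "k \<in> I n" "k \<in> B" "k \<notin> M" by blast
      then obtain a r where a: "a \<in> M" and r: "r \<in> carrier R" and k_eq: "k = a \<oplus> r \<otimes> x"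
        unfolding B_def add_iff cgenideal_def by blast
      have ac: "a \<in> carrier R" by (rule ideal.Icarr[OF M(1) a])
      have "r \<otimes> x = k \<oplus> \<ominus> a" using ac r x k_eq by (simp add: a_comm[of a] a_assoc r_neg)
      moreover have "\<ominus> a \<in> I n"
        using a MI[of n] additive_subgroup.a_inv_closed[OF ideal.axioms(1)[OF Ii]] by blast
      ultimately have rx: "r \<otimes> x \<in> I n"
        using k(1) additive_subgroup.a_closed[OF ideal.axioms(1)[OF Ii]] by simp
      have "r \<otimes> x \<notin> M"
        using k(3) k_eq a additive_subgroup.a_closed[OF ideal.axioms(1)[OF M(1)]] by auto
      then have ru: "r \<in> Units R" using socle r by blast
      then have "inv r \<otimes> (r \<otimes> x) = x" using r x by (simp add: m_assoc[symmetric])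
      then have "x \<in> I n" using ideal.I_l_closed[OF Ii rx, of "inv r"] ru by simp
      then have "PIdl x \<subseteq> I n" by (rule cgenideal_minimal[OF Ii])
      then have "B \<subseteq> I n"
        using MI[of n] additive_subgroup.a_closed[OF ideal.axioms(1)[OF Ii]]
        unfolding B_def set_add_def' by blast
      then show ?thesis by simp
    qed
    obtain N2 where N2: "\<And>n. N2 \<le> n \<Longrightarrow> I n \<inter> B = I N2 \<inter> B"
    proof (cases "\<exists>N. I N \<inter> B = M")
      case True
      then obtain N where N: "I N \<inter> B = M" by blast
      have "I n \<inter> B = I N \<inter> B" if "N \<le> n" for n
        using N anti[OF that] MI[of n] MB by blast
      then show thesis using that by blast
    next
      case False
      then have "I n \<inter> B = B" for n using simple[of n] by blast
      then show thesis using that by blast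
    qed
    let ?N = "max N1 N2"
    have "I n = I ?N" if n: "?N \<le> n" for n
    proof
      show "I n \<subseteq> I ?N" by (rule anti[OF n])
      show "I ?N \<subseteq> I n"
      proof
        fix u assume u: "u \<in> I ?N"
        have uc: "u \<in> carrier R" by (rule ideal.Icarr[OF Ii u])
        have "u \<in> I ?N <+> B" using u sup_left[OF Ii B] by blast
        also have "(I ?N <+> B :: 'a set) = I n <+> B" using N1[of ?N] N1[of n] n by simp
        finally obtain v b where v: "v \<in> I n" and b: "b \<in> B" and u_eq: "u = v \<oplus> b"
          unfolding add_iff by blast
        have vc: "v \<in> carrier R" by (rule ideal.Icarr[OF Ii v])
        have bc: "b \<in> carrier R" by (rule ideal.Icarr[OF B b])
        have "v \<in> I ?N" using v anti[OF n] by blast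
        then have "\<ominus> v \<in> I ?N" by (rule additive_subgroup.a_inv_closed[OF ideal.axioms(1)[OF Ii]])
        then have "\<ominus> v \<oplus> u \<in> I ?N"
          using u additive_subgroup.a_closed[OF ideal.axioms(1)[OF Ii]] by blast
        moreover have "\<ominus> v \<oplus> u = b" using u_eq vc bc by (simp add: r_neg1)
        ultimately have "b \<in> I ?N \<inter> B" using b by simp
        also have "I ?N \<inter> B = I n \<inter> B" using N2[of ?N] N2[of n] n by simp
        finally show "u \<in> I n"
          using u_eq v additive_subgroup.a_closed[OF ideal.axioms(1)[OF Ii]] by blast
      qed
    qed
    then show False using unstable by blast
  qed
  then have "dcc_above {\<zero>}" using zeroideal by blast
  moreover have "{\<zero>} \<subseteq> K" if "ideal K R" for K
    using additive_subgroup.zero_closed[OF ideal.axioms(1)[OF that]] by simp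
  ultimately have "\<exists>N. \<forall>n\<ge>N. I n = I N"
    if "\<And>n. ideal (I n) R" "\<And>n. I (Suc n) \<subseteq> I n" for I :: "nat \<Rightarrow> 'a set"
    using that unfolding dcc_above_def chain_above_def by blast
  then show ?thesis
    by (intro artinian_ring.intro artinian_ring_axioms.intro ring_axioms) blast
qed

text \<open>
  Every proper ideal consists of nonunits, hence lies in the nilradical, which is itself proper.
\<close>

lemma local_of_nilpotent_nonunits:
  assumes one: "\<one> \<noteq> \<zero>"
    and nonunits: "\<And>y. y \<in> carrier R \<Longrightarrow> y \<notin> Units R \<Longrightarrow> y \<in> nilradical R"
  shows "local_ring R"
proof -
  have "\<one> \<notin> nilradical R" using nilpotent_idempotent_eq_zero[of \<one>] one by auto
  then have proper: "nilradical R \<noteq> carrier R" by auto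
  have above: "J = nilradical R \<or> J = carrier R" if J: "ideal J R" "nilradical R \<subseteq> J" for J
  proof (cases "J = carrier R")
    case False
    then have "J \<subseteq> nilradical R"
      using nonunits proper_ideal_nonunit[OF J(1)] ideal.Icarr[OF J(1)] by blast
    then show ?thesis using J by blast
  qed simp
  have "maximalideal (nilradical R) R"
    by (rule maximalidealI[OF nilradical_ideal]) (use proper above in auto)
  moreover have "M = nilradical R" if "maximalideal M R" for M
  proof -
    interpret M: maximalideal M R by fact
    have "M \<subseteq> nilradical R"
      using nonunits proper_ideal_nonunit[OF M.is_ideal] M.I_notcarr M.Icarr by blast
    then show ?thesis
      using M.I_maximal[OF nilradical_ideal] proper ideal.Icarr[OF nilradical_ideal] by blast
  qed
  ultimately have "\<exists>!M. maximalideal M R" by blast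
  then show ?thesis by (intro local_ring.intro local_ring_axioms.intro is_cring)
qed

text \<open>
  The chain of the ideals \<open>(x\<^sup>n)\<close> stabilises, so \<open>x\<^sup>N (1 - r x) = 0\<close> for some \<open>N\<close> and \<open>r\<close>. In a local
  ring \<open>1 - r x\<close> is a unit when \<open>x\<close> is not. The ascending chain condition supplies the maximal
  ideal above a given nonunit.
\<close>

lemma artinian_local_nilpotent_nonunits:
  assumes noetherian: "noetherian_ring R" and "artinian_ring R" and "local_ring R"
    and x: "x \<in> carrier R" "x \<notin> Units R"
  shows "x \<in> nilradical R"
proof -
  interpret artinian: artinian_ring R by fact
  obtain M where M: "maximalideal M R" and unique: "\<And>K. maximalideal K R \<Longrightarrow> K = M"
    using local_ring.unique_maximalideal[OF \<open>local_ring R\<close>] by blast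
  have in_M: "y \<in> M" if y: "y \<in> carrier R" "y \<notin> Units R" for y
  proof -
    let ?\<F> = "{I. ideal I R \<and> y \<in> I \<and> I \<noteq> carrier R}"
    have "PIdl y \<in> ?\<F>"
      using y cgenideal_ideal cgenideal_self cgenideal_eq_carrier_iff by auto
    then obtain K where "K \<in> ?\<F>" and K_max: "\<And>L. L \<in> ?\<F> \<Longrightarrow> K \<subseteq> L \<Longrightarrow> L = K"
      using noetherian_ring.ideal_family_has_maximal[OF noetherian, of "PIdl y" ?\<F>] by blast
    then have K: "ideal K R" "y \<in> K" "K \<noteq> carrier R" by auto
    have "maximalideal K R"
    proof (rule maximalidealI[OF K(1)])
      show "carrier R \<noteq> K" using K(3) by simp
      show "L = K \<or> L = carrier R" if "ideal L R" "K \<subseteq> L" "L \<subseteq> carrier R" for L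
        using K_max[of L] that K(2) by blast
    qed
    then show "y \<in> M" using unique K(2) by blast
  qed
  have Mi: "ideal M R" and M_proper: "M \<noteq> carrier R"
    using M maximalideal.axioms(1) maximalideal.I_notcarr by blast+
  have powers: "PIdl (x [^] Suc n) \<subseteq> PIdl (x [^] n)" for n :: nat
  proof (rule cgenideal_minimal[OF cgenideal_ideal])
    have "x [^] Suc n = x \<otimes> x [^] n" using x by (simp add: m_comm)
    then show "x [^] Suc n \<in> PIdl (x [^] n)" using x(1) unfolding cgenideal_def by blast
  qed (use x in simp)
  have "\<exists>N::nat. \<forall>n\<ge>N. PIdl (x [^] n) = PIdl (x [^] N)"
    by (rule artinian.descending_chain_stabilizes[where I = "\<lambda>n. PIdl (x [^] n)", OF _ powers])
      (use x cgenideal_ideal in simp)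
  then obtain N :: nat where N: "\<forall>n\<ge>N. PIdl (x [^] n) = PIdl (x [^] N)" by blast
  have "x [^] N \<in> PIdl (x [^] Suc N)" using N[rule_format, of "Suc N"] cgenideal_self x by simp
  then obtain r where r: "r \<in> carrier R" and fix_eq: "x [^] N = r \<otimes> x [^] Suc N"
    by (auto simp: cgenideal_def)
  let ?p = "x [^] N" and ?u = "\<one> \<ominus> r \<otimes> x"
  have pc: "?p \<in> carrier R" and uc: "?u \<in> carrier R" using x r by simp_all
  have "r \<otimes> x \<otimes> ?p = ?p"
    using fix_eq r x m_comm[OF x(1) pc] by (simp add: m_assoc)
  then have kill: "?u \<otimes> ?p = \<zero>"
    using r x pc by (simp add: minus_eq l_distr l_minus r_neg)
  have unit: "?u \<in> Units R"
  proof (rule ccontr)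
    assume "?u \<notin> Units R"
    then have "?u \<in> M" using in_M uc by blast
    moreover have "r \<otimes> x \<in> M" by (rule ideal.I_l_closed[OF Mi in_M[OF x] r])
    ultimately have "?u \<oplus> r \<otimes> x \<in> M"
      using additive_subgroup.a_closed[OF ideal.axioms(1)[OF Mi]] by blast
    moreover have "?u \<oplus> r \<otimes> x = \<one>" using r x by (simp add: minus_eq a_assoc l_neg)
    ultimately show False using ideal.one_imp_carrier[OF Mi] M_proper by simp
  qed
  have "?p = inv ?u \<otimes> (?u \<otimes> ?p)"
    using m_assoc[OF Units_inv_closed[OF unit] uc pc] Units_l_inv[OF unit] pc by simp
  then have "?p = \<zero>" using kill unit by simp
  then show ?thesis using x by (auto simp: nilradical_def)
qed

lemma complete_nil_graphI:
  assumes "\<And>I J x y. \<lbrakk> nontrivial_ideal I R; nontrivial_ideal J R; I \<noteq> J; x \<in> I; y \<in> J \<rbrakk>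
      \<Longrightarrow> x \<otimes> y \<in> nilradical R"
  shows "complete_graph (nil_graph R)"
  unfolding complete_graph_def
proof (intro ballI impI)
  fix I J assume V: "I \<in> pverts (nil_graph R)" "J \<in> pverts (nil_graph R)" and "I \<noteq> J"
  then have "I \<cdot> J \<subseteq> nilradical R"
    using assms[of I J] by (auto simp: ideal_prod_subset_nilradical_iff nil_graph_def Let_def)
  then show "(I, J) \<in> parcs (nil_graph R)"
    using V \<open>I \<noteq> J\<close> unfolding nil_graph_def Let_def by simp
qed

lemma complete_nil_graph_of_nilpotent_nonunits:
  assumes nonunits: "\<And>y. y \<in> carrier R \<Longrightarrow> y \<notin> Units R \<Longrightarrow> y \<in> nilradical R"
  shows "complete_graph (nil_graph R)"
proof (rule complete_nil_graphI)
  fix I J x y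
  assume I: "nontrivial_ideal I R" and J: "nontrivial_ideal J R" and xy: "x \<in> I" "y \<in> J"
  have "x \<in> nilradical R" "y \<in> carrier R"
    using nonunits proper_ideal_nonunit ideal.Icarr I J xy unfolding nontrivial_ideal_def by metis+
  then show "x \<otimes> y \<in> nilradical R" by (rule ideal.I_r_closed[OF nilradical_ideal])
qed

section \<open>Ideals in a product of two fields\<close>

text \<open>
  A proper ideal that contains an element with nonzero first component is the first factor of the
  product: dividing by that component produces \<open>(1, 0)\<close>, and an element with nonzero second
  component would produce \<open>(0, 1)\<close> in the same way. The second factor is covered by exchanging
  the two fields.
\<close>

lemma ideal_of_product_of_fields:
  fixes F\<^sub>1 :: "('c, 'm) ring_scheme" and F\<^sub>2 :: "('d, 'n) ring_scheme"
  assumes F: "field F\<^sub>1" "field F\<^sub>2" and h: "h \<in> ring_iso R (RDirProd F\<^sub>1 F\<^sub>2)"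
    and I: "ideal I R" "I \<noteq> carrier R" and x: "x \<in> I" "fst (h x) \<noteq> \<zero>\<^bsub>F\<^sub>1\<^esub>"
  shows "I = {u \<in> carrier R. snd (h u) = \<zero>\<^bsub>F\<^sub>2\<^esub>}"
proof -
  interpret F1: field F\<^sub>1 by fact
  interpret F2: field F\<^sub>2 by fact
  have bij: "bij_betw h (carrier R) (carrier F\<^sub>1 \<times> carrier F\<^sub>2)"
    using h by (simp add: ring_iso_def RDirProd_carrier)
  have mem: "fst (h u) \<in> carrier F\<^sub>1" "snd (h u) \<in> carrier F\<^sub>2" if "u \<in> carrier R" for u
    using bij_betwE[OF bij] that by (simp_all add: mem_Times_iff)
  have h_mult: "h (u \<otimes> v) = (fst (h u) \<otimes>\<^bsub>F\<^sub>1\<^esub> fst (h v), snd (h u) \<otimes>\<^bsub>F\<^sub>2\<^esub> snd (h v))"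
    and h_add: "h (u \<oplus> v) = (fst (h u) \<oplus>\<^bsub>F\<^sub>1\<^esub> fst (h v), snd (h u) \<oplus>\<^bsub>F\<^sub>2\<^esub> snd (h v))"
    if "u \<in> carrier R" "v \<in> carrier R" for u v
    using h that by (auto simp: ring_iso_def ring_hom_def RDirProd_def DirProd_def monoid.defs
        split: prod.splits)
  have h_one: "h \<one> = (\<one>\<^bsub>F\<^sub>1\<^esub>, \<one>\<^bsub>F\<^sub>2\<^esub>)"
    using h by (auto simp: ring_iso_def ring_hom_def RDirProd_def DirProd_def monoid.defs)
  have preimage: "\<exists>u\<in>carrier R. h u = (a, b)" if "a \<in> carrier F\<^sub>1" "b \<in> carrier F\<^sub>2" for a b
  proof -
    have "(a, b) \<in> h ` carrier R" using bij_betw_imp_surj_on[OF bij] that by simp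
    then show ?thesis unfolding image_iff by (elim bexE) (rule bexI, simp_all)
  qed
  have inj: "u = v" if "u \<in> carrier R" "v \<in> carrier R" "h u = h v" for u v
    using bij_betw_imp_inj_on[OF bij] that by (simp add: inj_on_def)
  have Ic: "u \<in> carrier R" if "u \<in> I" for u by (rule ideal.Icarr[OF I(1) that])
  obtain e where e: "e \<in> carrier R" "h e = (\<one>\<^bsub>F\<^sub>1\<^esub>, \<zero>\<^bsub>F\<^sub>2\<^esub>)" using preimage by blast
  obtain f where f: "f \<in> carrier R" "h f = (\<zero>\<^bsub>F\<^sub>1\<^esub>, \<one>\<^bsub>F\<^sub>2\<^esub>)" using preimage by blast
  have "fst (h x) \<in> Units F\<^sub>1" using mem[OF Ic[OF x(1)]] x(2) by (simp add: F1.field_Units)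
  moreover obtain c where c: "c \<in> carrier R" "h c = (inv\<^bsub>F\<^sub>1\<^esub> fst (h x), \<zero>\<^bsub>F\<^sub>2\<^esub>)"
    using preimage calculation by blast
  ultimately have "h (c \<otimes> x) = h e"
    using h_mult[OF c(1) Ic[OF x(1)]] mem[OF Ic[OF x(1)]] e by simp
  then have "c \<otimes> x = e" using inj[of "c \<otimes> x" e] c(1) e(1) Ic[OF x(1)] by simp
  then have eI: "e \<in> I" using ideal.I_l_closed[OF I(1) x(1) c(1)] by simp
  show ?thesis
  proof (intro equalityI subsetI)
    fix u assume u: "u \<in> I"
    have "snd (h u) = \<zero>\<^bsub>F\<^sub>2\<^esub>"
    proof (rule ccontr)
      assume "snd (h u) \<noteq> \<zero>\<^bsub>F\<^sub>2\<^esub>"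
      then have "snd (h u) \<in> Units F\<^sub>2" using mem[OF Ic[OF u]] by (simp add: F2.field_Units)
      moreover obtain d where d: "d \<in> carrier R" "h d = (\<zero>\<^bsub>F\<^sub>1\<^esub>, inv\<^bsub>F\<^sub>2\<^esub> snd (h u))"
        using preimage calculation by blast
      ultimately have "h (d \<otimes> u) = h f"
        using h_mult[OF d(1) Ic[OF u]] mem[OF Ic[OF u]] f by simp
      then have "d \<otimes> u = f" using inj[of "d \<otimes> u" f] d(1) f(1) Ic[OF u] by simp
      then have "f \<in> I" using ideal.I_l_closed[OF I(1) u d(1)] by simp
      then have "e \<oplus> f \<in> I"
        using eI additive_subgroup.a_closed[OF ideal.axioms(1)[OF I(1)]] by blast
      moreover have "h (e \<oplus> f) = h \<one>" using h_add[OF e(1) f(1)] e f h_one by simp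
      then have "e \<oplus> f = \<one>" using inj[of "e \<oplus> f" \<one>] e(1) f(1) by simp
      ultimately show False using ideal.one_imp_carrier[OF I(1)] I(2) by simp
    qed
    then show "u \<in> {u \<in> carrier R. snd (h u) = \<zero>\<^bsub>F\<^sub>2\<^esub>}" using Ic[OF u] by simp
  next
    fix u assume "u \<in> {u \<in> carrier R. snd (h u) = \<zero>\<^bsub>F\<^sub>2\<^esub>}"
    then have u: "u \<in> carrier R" "snd (h u) = \<zero>\<^bsub>F\<^sub>2\<^esub>" by auto
    have "h (u \<otimes> e) = h u"
      using h_mult[OF u(1) e(1)] e u mem[OF u(1)] by (simp add: prod_eq_iff)
    then have "u \<otimes> e = u" using inj[of "u \<otimes> e" u] u(1) e(1) by simp
    then show "u \<in> I" using ideal.I_l_closed[OF I(1) eI u(1)] by simp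
  qed
qed

text \<open>
  If two elements of proper ideals have a nonzero product, they are both nonzero in the same
  component, and then both ideals are equal to the corresponding factor.
\<close>

lemma complete_nil_graph_product_of_fields:
  fixes F\<^sub>1 :: "('c, 'm) ring_scheme" and F\<^sub>2 :: "('d, 'n) ring_scheme"
  assumes F: "field F\<^sub>1" "field F\<^sub>2" and iso: "R \<simeq> RDirProd F\<^sub>1 F\<^sub>2"
  shows "complete_graph (nil_graph R)"
proof (rule complete_nil_graphI)
  fix I J x y
  assume I: "nontrivial_ideal I R" and J: "nontrivial_ideal J R" and ne: "I \<noteq> J"
    and x: "x \<in> I" and y: "y \<in> J"
  interpret F1: field F\<^sub>1 by fact
  interpret F2: field F\<^sub>2 by fact
  obtain h where h: "h \<in> ring_iso R (RDirProd F\<^sub>1 F\<^sub>2)" using iso unfolding is_ring_iso_def by blast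
  (* The isomorphism onto the product with exchanged factors, to treat the second component. *)
  define g where "g = (\<lambda>(a, b). (b, a)) \<circ> h"
  have g: "g \<in> ring_iso R (RDirProd F\<^sub>2 F\<^sub>1)"
    unfolding g_def by (rule ring_iso_set_trans[OF h RDirProd_iso1])
  have g_fst: "fst (g u) = snd (h u)" for u by (simp add: g_def split: prod.splits)
  have Ii: "ideal I R" "I \<noteq> carrier R" and Ji: "ideal J R" "J \<noteq> carrier R"
    using I J unfolding nontrivial_ideal_def by auto
  have xc: "x \<in> carrier R" and yc: "y \<in> carrier R" using Ii Ji x y ideal.Icarr by metis+
  have bij: "bij_betw h (carrier R) (carrier F\<^sub>1 \<times> carrier F\<^sub>2)"
    using h by (simp add: ring_iso_def RDirProd_carrier)
  have mem: "fst (h u) \<in> carrier F\<^sub>1" "snd (h u) \<in> carrier F\<^sub>2" if "u \<in> carrier R" for u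
    using bij_betwE[OF bij] that by (simp_all add: mem_Times_iff)
  have "fst (h x) = \<zero>\<^bsub>F\<^sub>1\<^esub> \<or> fst (h y) = \<zero>\<^bsub>F\<^sub>1\<^esub>"
    using ideal_of_product_of_fields[OF F h Ii x] ideal_of_product_of_fields[OF F h Ji y] ne by argo
  moreover have "snd (h x) = \<zero>\<^bsub>F\<^sub>2\<^esub> \<or> snd (h y) = \<zero>\<^bsub>F\<^sub>2\<^esub>"
    using ideal_of_product_of_fields[OF F(2,1) g Ii x] ideal_of_product_of_fields[OF F(2,1) g Ji y] ne
    unfolding g_fst by argo
  moreover have "h (x \<otimes> y) = (fst (h x) \<otimes>\<^bsub>F\<^sub>1\<^esub> fst (h y), snd (h x) \<otimes>\<^bsub>F\<^sub>2\<^esub> snd (h y))"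
    using h xc yc by (auto simp: ring_iso_def ring_hom_def RDirProd_def DirProd_def monoid.defs
        split: prod.splits)
  ultimately have "h (x \<otimes> y) = (\<zero>\<^bsub>F\<^sub>1\<^esub>, \<zero>\<^bsub>F\<^sub>2\<^esub>)" using mem[OF xc] mem[OF yc] by auto
  moreover have "h \<zero> = (\<zero>\<^bsub>F\<^sub>1\<^esub>, \<zero>\<^bsub>F\<^sub>2\<^esub>)"
  proof -
    have "h \<in> ring_hom R (RDirProd F\<^sub>1 F\<^sub>2)" using h by (simp add: ring_iso_def)
    then show ?thesis
      using ring_hom_zero[OF _ ring_axioms RDirProd_ring[OF F1.ring_axioms F2.ring_axioms]]
      by (simp add: RDirProd_def DirProd_def monoid.defs)
  qed
  moreover have "inj_on h (carrier R)" using bij by (rule bij_betw_imp_inj_on)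
  ultimately have "x \<otimes> y = \<zero>" using xc yc by (simp add: inj_on_def)
  then show "x \<otimes> y \<in> nilradical R"
    using additive_subgroup.zero_closed[OF ideal.axioms(1)[OF nilradical_ideal]] by simp
qed

section \<open>Characterisation of complete nil-graphs\<close>

text \<open>
  Without nontrivial idempotents, a nonunit that some nonzero nonunit multiplies into the
  nilradical is nilpotent. This is applied to a zero divisor \<open>a\<close>, and then to an arbitrary nonunit
  with the nilpotent element \<open>a\<close> as multiplier.
\<close>

lemma complete_nil_graph_nilpotent_nonunits:
  assumes complete: "complete_graph (nil_graph R)" and one: "\<one> \<noteq> \<zero>" and "\<not> domain R"
    and connected: "\<And>e. \<lbrakk> e \<in> carrier R; e \<otimes> e = e \<rbrakk> \<Longrightarrow> e = \<zero> \<or> e = \<one>"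
    and y: "y \<in> carrier R" "y \<notin> Units R"
  shows "y \<in> nilradical R"
proof -
  have nilpotent: "u \<in> nilradical R"
    if "u \<in> carrier R" "u \<notin> Units R" "z \<in> carrier R" "z \<noteq> \<zero>" "z \<notin> Units R"
      "u \<otimes> z \<in> nilradical R" for u z
    using complete_nil_graph_idempotent[OF complete] connected that by blast
  obtain a b where a: "a \<in> carrier R" "a \<noteq> \<zero>" and b: "b \<in> carrier R" "b \<noteq> \<zero>" and ab: "a \<otimes> b = \<zero>"
    using \<open>\<not> domain R\<close> one is_cring unfolding domain_def domain_axioms_def by blast
  have au: "a \<notin> Units R" using a b ab Units_l_cancel[of a b \<zero>] by auto
  have bu: "b \<notin> Units R" using a b ab m_comm[of b a] Units_l_cancel[of b a \<zero>] by auto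
  have "\<zero> \<in> nilradical R"
    by (rule additive_subgroup.zero_closed[OF ideal.axioms(1)[OF nilradical_ideal]])
  then have "a \<in> nilradical R" using nilpotent[of a b] a au b bu ab by simp
  then have "y \<otimes> a \<in> nilradical R" using ideal.I_l_closed[OF nilradical_ideal] y by blast
  then show ?thesis using nilpotent[of y a] y a au by blast
qed

end

theorem theorem1:
  fixes R :: "('a, 'b) ring_scheme"
  assumes "cring R" and "\<one>\<^bsub>R\<^esub> \<noteq> \<zero>\<^bsub>R\<^esub>" and "noetherian_ring R" and "\<not> domain R"
  shows "complete_graph (nil_graph R) \<longleftrightarrow>
    (artinian_ring R \<and> local_ring R) \<or>
    (\<exists>(F\<^sub>1 :: 'a ring) (F\<^sub>2 :: 'a ring). field F\<^sub>1 \<and> field F\<^sub>2 \<and> R \<simeq> RDirProd F\<^sub>1 F\<^sub>2)"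
proof -
  interpret cring R by fact
  show ?thesis
  proof
    assume complete: "complete_graph (nil_graph R)"
    show "(artinian_ring R \<and> local_ring R) \<or>
      (\<exists>(F\<^sub>1 :: 'a ring) (F\<^sub>2 :: 'a ring). field F\<^sub>1 \<and> field F\<^sub>2 \<and> R \<simeq> RDirProd F\<^sub>1 F\<^sub>2)"
    proof (cases "\<exists>e\<in>carrier R. e \<otimes>\<^bsub>R\<^esub> e = e \<and> e \<noteq> \<zero>\<^bsub>R\<^esub> \<and> e \<noteq> \<one>\<^bsub>R\<^esub>")
      case True
      then obtain e where e: "e \<in> carrier R" "e \<otimes>\<^bsub>R\<^esub> e = e" "e \<noteq> \<zero>\<^bsub>R\<^esub>" "e \<noteq> \<one>\<^bsub>R\<^esub>" by blast
      show ?thesis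
        using idempotent_product_of_fields[OF e]
          complete_nil_graph_idempotent_maximalideal[OF complete e]
          complete_nil_graph_idempotent_maximalideal[OF complete nontrivial_idempotent_compl(1-4)[OF e]]
        by blast
    next
      case False
      then have "y \<in> nilradical R" if "y \<in> carrier R" "y \<notin> Units R" for y
        using complete_nil_graph_nilpotent_nonunits[OF complete assms(2,4) _ that] by blast
      then show ?thesis
        using artinian_of_nilpotent_nonunits[OF assms(3)] local_of_nilpotent_nonunits[OF assms(2)]
        by blast
    qed
  next
    assume "(artinian_ring R \<and> local_ring R) \<or>
      (\<exists>(F\<^sub>1 :: 'a ring) (F\<^sub>2 :: 'a ring). field F\<^sub>1 \<and> field F\<^sub>2 \<and> R \<simeq> RDirProd F\<^sub>1 F\<^sub>2)"
    then show "complete_graph (nil_graph R)"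
      using complete_nil_graph_of_nilpotent_nonunits artinian_local_nilpotent_nonunits[OF assms(3)]
        complete_nil_graph_product_of_fields by blast
  qed
qed

end
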